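(* Let $F,G:\mathbb{R}\to\mathbb{R}$ be three times differentiable functions with derivatives $F'=f$, $G'=g$ such that $$[F(b)-F(a)]\,g\Bigl(\frac{a+b}{2}\Bigr)=[G(b)-G(a)]\,f\Bigl(\frac{a+b}{2}\Bigr)\quad\text{for all } a,b\in\mathbb{R}.$$ Then one of the following possibilities holds: (a) $\{1,F,G\}$ are linearly dependent on $\mathbb{R}$; (b) $F,G\in\mathrm{span}\{1,x,x^2\}$, $x\in\mathbb{R}$; (c) there exists a non-zero real number $\mu$ such that $F,G\in\mathrm{span}\{1,e^{\mu x},e^{-\mu x}\}$, $x\in\mathbb{R}$; (d) there exists a non-zero real number $\mu$ such that $F,G\in\mathrm{span}\{1,\sin(\mu x),\cos(\mu x)\}$, $x\in\mathbb{R}$.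
   Context: Spans and linear dependence are over $\mathbb{R}$, for real-valued functions on $\mathbb{R}$; $1$ denotes the constant function. *)

theory Defs
  imports "HOL-Analysis.Analysis" "HOL-Library.Function_Algebras"
begin

text \<open>
  The pointwise real vector space structure on functions, so that the library's
  \<^const>\<open>span\<close> applies to sets of functions. Addition and zero come from the
  library's function algebras.
\<close>

instantiation "fun" :: (type, real_vector) real_vector
begin

definition scaleR_fun :: "real \<Rightarrow> ('a \<Rightarrow> 'b) \<Rightarrow> 'a \<Rightarrow> 'b"
  where "scaleR_fun c h = (\<lambda>x. c *\<^sub>R h x)"

instance
  by standard (auto simp: scaleR_fun_def fun_eq_iff scaleR_add_left scaleR_add_right)

end

text \<open>
  Linear dependence of a finite family. The library's \<^const>\<open>dependent\<close> is about sets and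
  therefore ignores repeated members: for \<open>F = G\<close> the family \<open>1, F, G\<close> is linearly dependent,
  whereas the set \<open>{1, F, G} = {1, F}\<close> need not be.
\<close>

definition linearly_dependent :: "'a::real_vector list \<Rightarrow> bool"
  where "linearly_dependent vs \<longleftrightarrow>
    (\<exists>c :: nat \<Rightarrow> real. (\<exists>i<length vs. c i \<noteq> 0) \<and> (\<Sum>i<length vs. c i *\<^sub>R (vs ! i)) = 0)"

definition times_differentiable :: "nat \<Rightarrow> (real \<Rightarrow> real) \<Rightarrow> bool"
  where "times_differentiable n h \<longleftrightarrow> (\<forall>k<n. \<forall>x. ((deriv ^^ k) h) differentiable (at x))"

end

theory Submission
  imports Defs
begin

text \<open>
  Differentiating the equation for \<open>a = x - h\<close>, \<open>b = x + h\<close> three times in \<open>h\<close> shows that the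
  vector \<open>u = (f, g)\<close> satisfies \<open>u(x + h) + u(x - h) \<parallel> u(x)\<close> and
  \<open>u''(x + h) + u''(x - h) \<parallel> u(x)\<close>. For \<open>h = 0\<close> the latter says that the Wronskian of \<open>f\<close> and \<open>g\<close>
  is constant. If it is nonzero, then \<open>u'' = q u\<close> for some function \<open>q\<close>, and the two relations
  together give \<open>(q(x + h) - q(x - h)) det (u(x - h), u(x)) = 0\<close>, where the determinant does not vanish
  for small \<open>h \<noteq> 0\<close>. So \<open>q\<close> is locally constant, hence constant, and the sign of \<open>q\<close>
  decides between (b), (c) and (d). If the Wronskian is zero and \<open>g\<close> does not vanish identically,
  then \<open>f = c g\<close> on some interval, so the function \<open>F - c G\<close> is symmetric about every point of that
  interval and is therefore constant, which is (a).
\<close>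

section \<open>Locally constant functions and differentiation of symmetric relations\<close>

text \<open>Local constancy itself supplies the zero derivative, so this applies to a multiplier
  built from second derivatives whose continuity is unknown.\<close>

lemma locally_constant_real_imp_constant:
  fixes q :: "real \<Rightarrow> real"
  assumes "\<And>x. \<exists>d>0. \<forall>y. \<bar>y - x\<bar> < d \<longrightarrow> q y = q x"
  shows "q x = q y"
proof -
  have "(q has_real_derivative 0) (at x)" for x
  proof -
    obtain d where d: "d > 0" "\<forall>y. \<bar>y - x\<bar> < d \<longrightarrow> q y = q x"
      using assms by blast
    show ?thesis
    proof (rule has_field_derivative_transform_within[of "\<lambda>_. q x" 0 x UNIV d])
      show "q x = q y" if "dist y x < d" for y
        using d(2) that by (metis dist_real_def)
    qed (use d(1) in simp_all)
  qed
  then show ?thesis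
    by (metis DERIV_isconst_all)
qed

text \<open>Both sides are differentiated in \<open>h\<close> with \<open>x\<close> fixed. The inner
  derivative of \<open>x - h\<close> flips the sign of \<open>c\<close>, so repeated use alternates
  between differences and sums.\<close>

lemma symmetric_difference_eq_deriv:
  fixes P Q p q :: "real \<Rightarrow> real"
  assumes P: "\<And>x. (P has_real_derivative p x) (at x)"
    and Q: "\<And>x. (Q has_real_derivative q x) (at x)"
    and eq: "\<And>h. (P (x + h) + c * P (x - h)) * \<alpha> = (Q (x + h) + c * Q (x - h)) * \<beta>"
  shows "(p (x + h) - c * p (x - h)) * \<alpha> = (q (x + h) - c * q (x - h)) * \<beta>"
proof -
  have *: "((\<lambda>h. (P (x + h) + c * P (x - h)) * \<alpha>)
    has_real_derivative (p (x + h) - c * p (x - h)) * \<alpha>) (at h)"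
    if P: "\<And>x. (P has_real_derivative p x) (at x)" for P p :: "real \<Rightarrow> real" and \<alpha>
    by (rule derivative_eq_intros DERIV_chain2[OF P] refl)+ (simp add: algebra_simps)
  show ?thesis
    using *[OF P, of \<alpha>] *[OF Q, of \<beta>] unfolding eq by (rule DERIV_unique)
qed

lemma times_differentiable_3E:
  assumes "times_differentiable 3 F" and F: "\<And>x. (F has_real_derivative f x) (at x)"
  obtains f1 f2 where "\<And>x. (f has_real_derivative f1 x) (at x)"
    and "\<And>x. (f1 has_real_derivative f2 x) (at x)"
proof -
  have d: "((deriv ^^ k) F) differentiable (at x)" if "k < 3" for k x
    using assms(1) that unfolding times_differentiable_def by blast
  have f: "deriv F = f"
    using F by (auto intro: DERIV_imp_deriv)
  have "(f has_real_derivative deriv f x) (at x)" for x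
    using d[of 1 x] f by (simp add: DERIV_deriv_iff_real_differentiable)
  moreover have "(deriv f has_real_derivative deriv (deriv f) x) (at x)" for x
    using d[of 2 x] f by (simp add: DERIV_deriv_iff_real_differentiable numeral_2_eq_2)
  ultimately show thesis
    by (rule that)
qed

section \<open>Coefficient criteria for spans and linear dependence\<close>

lemma mem_span3I:
  fixes F a b c :: "real \<Rightarrow> real"
  assumes "\<And>x. F x = \<alpha> * a x + \<beta> * b x + \<gamma> * c x"
  shows "F \<in> span {a, b, c}"
proof -
  have "F = \<alpha> *\<^sub>R a + \<beta> *\<^sub>R b + \<gamma> *\<^sub>R c"
    using assms by (simp add: fun_eq_iff scaleR_fun_def)
  also have "\<dots> \<in> span {a, b, c}"
    by (intro span_add span_scale span_base) auto
  finally show ?thesis .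
qed

lemma linearly_dependent3I:
  fixes a b c :: "real \<Rightarrow> real"
  assumes "\<And>x. \<alpha> * a x + \<beta> * b x + \<gamma> * c x = 0" and "\<alpha> \<noteq> 0 \<or> \<beta> \<noteq> 0 \<or> \<gamma> \<noteq> 0"
  shows "linearly_dependent [a, b, c]"
  unfolding linearly_dependent_def
proof (intro exI[of _ "(!) [\<alpha>, \<beta>, \<gamma>]"] conjI)
  show "\<exists>i<length [a, b, c]. [\<alpha>, \<beta>, \<gamma>] ! i \<noteq> 0"
    using assms(2) by (auto simp: less_Suc_eq numeral_3_eq_3)
  show "(\<Sum>i<length [a, b, c]. ([\<alpha>, \<beta>, \<gamma>] ! i) *\<^sub>R ([a, b, c] ! i)) = 0"
    using assms(1) by (simp add: fun_eq_iff scaleR_fun_def)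
qed

section \<open>The case of vanishing Wronskian\<close>

text \<open>Cancelling \<open>g\<close> at the midpoint turns the equation into a reflection
  symmetry of \<open>F - c * G\<close> about every point near \<open>x0\<close>. Two such
  reflections compose to a small translation, which acts on the whole line.\<close>

lemma linearly_dependent_if_proportional_near:
  fixes F G f g :: "real \<Rightarrow> real"
  assumes eq: "\<And>a b. (F b - F a) * g ((a + b) / 2) = (G b - G a) * f ((a + b) / 2)"
    and d: "d > 0" and near: "\<And>y. \<bar>y - x0\<bar> < d \<Longrightarrow> g y \<noteq> 0 \<and> f y = c * g y"
  shows "linearly_dependent [(\<lambda>x. 1), F, G]"
proof -
  define K where "K = (\<lambda>x. F x - c * G x)"
  have refl: "K b = K a" if "\<bar>(a + b) / 2 - x0\<bar> < d" for a b
  proof -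
    have "(F b - F a) * g ((a + b) / 2) = ((G b - G a) * c) * g ((a + b) / 2)"
      using eq[of b a] near[OF that] by simp
    then have "F b - F a = (G b - G a) * c"
      using near[OF that] by (metis mult_right_cancel)
    then show ?thesis
      by (simp add: K_def algebra_simps)
  qed
  have const: "K x = K y" for x y
  proof (rule locally_constant_real_imp_constant[of K])
    fix y
    \<comment> \<open>The midpoint of \<open>z\<close> and \<open>2 * x0 - y\<close> is
      \<open>x0 + (z - y) / 2\<close>, so the radius \<open>d\<close> serves for every
      \<open>y\<close>, however far from \<open>x0\<close>.\<close>
    have "K z = K (2 * x0 - y)" if "\<bar>z - y\<bar> < d" for z
      using that by (intro refl) (auto simp: abs_if field_simps split: if_splits)
    then have "K z = K y" if "\<bar>z - y\<bar> < d" for z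
      using that d by simp
    then show "\<exists>d>0. \<forall>z. \<bar>z - y\<bar> < d \<longrightarrow> K z = K y"
      using d by blast
  qed
  show ?thesis
    by (rule linearly_dependent3I[of "- K 0" _ 1 _ "- c"])
      (use const[of _ 0] in \<open>auto simp: K_def algebra_simps\<close>)
qed

lemma linearly_dependent_if_wronskian_0:
  fixes F G f g :: "real \<Rightarrow> real"
  assumes G: "\<And>x. (G has_real_derivative g x) (at x)"
    and f: "\<And>x. (f has_real_derivative f1 x) (at x)"
    and g: "\<And>x. (g has_real_derivative g1 x) (at x)"
    and eq: "\<And>a b. (F b - F a) * g ((a + b) / 2) = (G b - G a) * f ((a + b) / 2)"
    and W: "\<And>x. f1 x * g x = g1 x * f x"
  shows "linearly_dependent [(\<lambda>x. 1), F, G]"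
proof (cases "\<forall>x. g x = 0")
  case True
  then have "G x = G 0" for x
    using G by (metis DERIV_isconst_all)
  then show ?thesis
    by (intro linearly_dependent3I[of "- G 0" _ 0 _ 1]) auto
next
  case False
  then obtain x0 where "g x0 \<noteq> 0"
    by blast
  moreover have "isCont g x0"
    using g by (rule DERIV_isCont)
  ultimately have "\<forall>\<^sub>F y in nhds x0. g y \<noteq> 0"
    by (intro tendsto_imp_eventually_ne) (auto simp: isCont_def tendsto_at_iff_tendsto_nhds)
  then obtain d where d: "d > 0" "\<And>y. \<bar>y - x0\<bar> < d \<Longrightarrow> g y \<noteq> 0"
    by (auto simp: eventually_nhds_metric dist_real_def)
  \<comment> \<open>The numerator of the derivative of \<open>f / g\<close> is the
    Wronskian.\<close>
  have "\<exists>c. \<forall>y\<in>ball x0 d. f y / g y = c"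
  proof (rule has_field_derivative_zero_constant)
    fix y assume "y \<in> ball x0 d"
    then have "g y \<noteq> 0"
      using d by (simp add: dist_real_def abs_minus_commute)
    then have "((\<lambda>y. f y / g y) has_real_derivative (f1 y * g y - f y * g1 y) / (g y * g y)) (at y)"
      by (intro DERIV_divide f g)
    then show "((\<lambda>y. f y / g y) has_real_derivative 0) (at y within ball x0 d)"
      using W[of y] by (simp add: has_field_derivative_at_within mult.commute)
  qed simp
  then obtain c where "\<forall>y\<in>ball x0 d. f y / g y = c"
    by blast
  then have "f y / g y = c" if "\<bar>y - x0\<bar> < d" for y
    using that by (simp add: dist_real_def abs_minus_commute)
  with d(2) have "g y \<noteq> 0 \<and> f y = c * g y" if "\<bar>y - x0\<bar> < d" for y
    using that by (metis nonzero_divide_eq_eq)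
  with eq d(1) show ?thesis
    by (rule linearly_dependent_if_proportional_near)
qed

section \<open>Nonvanishing minors near a point of nonzero Wronskian\<close>

text \<open>As a function of \<open>s\<close> the minor vanishes at \<open>s = t\<close>. By the
  mean value theorem it suffices that its derivative, a Wronskian with the two rows taken at
  different points, is nonzero near the diagonal point; this follows by continuity in both
  points.\<close>

lemma minor_nonzero_near:
  fixes f g f1 g1 :: "real \<Rightarrow> real"
  assumes f: "\<And>x. (f has_real_derivative f1 x) (at x)"
    and g: "\<And>x. (g has_real_derivative g1 x) (at x)"
    and cont: "isCont f1 x0" "isCont g1 x0"
    and W: "f1 x0 * g x0 - g1 x0 * f x0 \<noteq> 0"
  shows "\<exists>d>0. \<forall>s t. \<bar>s - x0\<bar> < d \<longrightarrow> \<bar>t - x0\<bar> < d \<longrightarrow> s < t \<longrightarrow> f s * g t - g s * f t \<noteq> 0"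
proof -
  have lim: "(h \<longlongrightarrow> h x0) (nhds x0)" if "isCont h x0" for h :: "real \<Rightarrow> real"
    using that by (simp add: isCont_def tendsto_at_iff_tendsto_nhds)
  note lims = filterlim_compose[OF lim filterlim_fst] filterlim_compose[OF lim filterlim_snd]
  have "((\<lambda>p. f1 (fst p) * g (snd p) - g1 (fst p) * f (snd p))
      \<longlongrightarrow> f1 x0 * g x0 - g1 x0 * f x0) (nhds x0 \<times>\<^sub>F nhds x0)"
    by (intro tendsto_intros lims cont DERIV_isCont[OF f] DERIV_isCont[OF g])
  then have "\<forall>\<^sub>F p in nhds x0 \<times>\<^sub>F nhds x0. f1 (fst p) * g (snd p) - g1 (fst p) * f (snd p) \<noteq> 0"
    using W by (rule tendsto_imp_eventually_ne)
  then obtain Q where "\<forall>\<^sub>F x in nhds x0. Q x"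
    and Q: "\<And>s t. Q s \<Longrightarrow> Q t \<Longrightarrow> f1 s * g t - g1 s * f t \<noteq> 0"
    unfolding eventually_prod_same fst_conv snd_conv by blast
  then obtain d where d: "d > 0" and "\<And>s. \<bar>s - x0\<bar> < d \<Longrightarrow> Q s"
    by (auto simp: eventually_nhds_metric dist_real_def)
  with Q have nz: "f1 s * g t - g1 s * f t \<noteq> 0" if "\<bar>s - x0\<bar> < d" "\<bar>t - x0\<bar> < d" for s t
    using that by blast
  have "f s * g t - g s * f t \<noteq> 0" if st: "\<bar>s - x0\<bar> < d" "\<bar>t - x0\<bar> < d" "s < t" for s t
  proof -
    have "((\<lambda>z. f z * g t - g z * f t) has_real_derivative f1 z * g t - g1 z * f t) (at z)" for z
      by (intro DERIV_diff DERIV_cmult_right f g)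
    then obtain z where z: "s < z" "z < t"
      and "(f t * g t - g t * f t) - (f s * g t - g s * f t) = (t - s) * (f1 z * g t - g1 z * f t)"
      using MVT2[OF \<open>s < t\<close>, of "\<lambda>z. f z * g t - g z * f t" "\<lambda>z. f1 z * g t - g1 z * f t"] by blast
    moreover have "f1 z * g t - g1 z * f t \<noteq> 0"
      using z st by (intro nz) auto
    ultimately show ?thesis
      using \<open>s < t\<close> by auto
  qed
  with d show ?thesis
    by blast
qed

section \<open>Solutions of F''' = q F' by the sign of q\<close>

lemma span_if_third_deriv_0:
  fixes F f f1 :: "real \<Rightarrow> real"
  assumes F: "\<And>x. (F has_real_derivative f x) (at x)"
    and f: "\<And>x. (f has_real_derivative f1 x) (at x)"
    and f1: "\<And>x. (f1 has_real_derivative 0) (at x)"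
  shows "F \<in> span {(\<lambda>x. 1), (\<lambda>x. x), (\<lambda>x. x\<^sup>2)}"
proof -
  have 1: "f1 x = f1 0" for x
    using f1 by (metis DERIV_isconst_all)
  have "((\<lambda>x. f x - f1 0 * x) has_real_derivative 0) (at x)" for x
    by (rule derivative_eq_intros f refl)+ (simp add: 1[of x])
  then have "f x - f1 0 * x = f 0 - f1 0 * 0" for x
    by (rule DERIV_isconst_all[rule_format])
  then have 2: "f x = f 0 + f1 0 * x" for x
    by (metis add.commute diff_add_cancel diff_zero mult_zero_right)
  have "((\<lambda>x. F x - f 0 * x - f1 0 / 2 * x\<^sup>2) has_real_derivative 0) (at x)" for x
    by (rule derivative_eq_intros F refl)+ (simp add: 2[of x])
  then have 3: "F x - f 0 * x - f1 0 / 2 * x\<^sup>2 = F 0 - f 0 * 0 - f1 0 / 2 * 0\<^sup>2" for x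
    by (rule DERIV_isconst_all[rule_format])
  have "F x = F 0 * 1 + f 0 * x + f1 0 / 2 * x\<^sup>2" for x
    using 3[of x] by simp
  then show ?thesis
    by (rule mem_span3I)
qed

text \<open>For nonzero \<open>q\<close> this recovers \<open>F\<close> from \<open>f1\<close>, so
  only the second-order equation for \<open>f\<close> remains to be solved.\<close>

lemma third_deriv_eq_cmult:
  fixes F f f1 :: "real \<Rightarrow> real"
  assumes F: "\<And>x. (F has_real_derivative f x) (at x)"
    and f1: "\<And>x. (f1 has_real_derivative q * f x) (at x)"
  shows "q * F x = f1 x + (q * F 0 - f1 0)"
proof -
  have "((\<lambda>x. q * F x - f1 x) has_real_derivative 0) (at x)" for x
    by (rule derivative_eq_intros F f1 refl)+ simp
  then have "q * F x - f1 x = q * F 0 - f1 0"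
    by (rule DERIV_isconst_all[rule_format])
  then show ?thesis
    by simp
qed

text \<open>The operator D^2 - \<mu>^2 factors: for \<nu> = \<mu> and \<nu> = -\<mu>,
  \<open>f1 + \<nu> * f\<close> solves y' = \<nu> y. Half the sum of the two solutions is
  \<open>f1\<close>.\<close>

lemma span_if_third_deriv_pos:
  fixes F f f1 :: "real \<Rightarrow> real"
  assumes F: "\<And>x. (F has_real_derivative f x) (at x)"
    and f: "\<And>x. (f has_real_derivative f1 x) (at x)"
    and f1: "\<And>x. (f1 has_real_derivative \<mu>\<^sup>2 * f x) (at x)"
    and "\<mu> \<noteq> 0"
  shows "F \<in> span {(\<lambda>x. 1), (\<lambda>x. exp (\<mu> * x)), (\<lambda>x. exp (- \<mu> * x))}"
proof -
  have const: "(f1 x + \<nu> * f x) * exp (- \<nu> * x) = f1 0 + \<nu> * f 0" if "\<nu>\<^sup>2 = \<mu>\<^sup>2" for \<nu> x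
  proof -
    have "((\<lambda>x. (f1 x + \<nu> * f x) * exp (- \<nu> * x)) has_real_derivative 0) (at x)" for x
      by (rule derivative_eq_intros f f1 refl)+
        (use that in \<open>simp add: power2_eq_square algebra_simps\<close>)
    then have "(f1 x + \<nu> * f x) * exp (- \<nu> * x) = (f1 0 + \<nu> * f 0) * exp (- \<nu> * 0)"
      by (rule DERIV_isconst_all[rule_format])
    then show ?thesis
      by simp
  qed
  have sol: "f1 x + \<nu> * f x = (f1 0 + \<nu> * f 0) * exp (\<nu> * x)" if "\<nu>\<^sup>2 = \<mu>\<^sup>2" for \<nu> x
    using const[OF that, of x] by (simp add: exp_minus field_simps)
  define A B where "A = (f1 0 + \<mu> * f 0) / 2" and "B = (f1 0 - \<mu> * f 0) / 2"
  have "f1 x = A * exp (\<mu> * x) + B * exp (- \<mu> * x)" for x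
    using sol[of \<mu> x] sol[of "- \<mu>" x] by (simp add: A_def B_def field_simps)
  then have "\<mu>\<^sup>2 * F x = A * exp (\<mu> * x) + B * exp (- \<mu> * x) + (\<mu>\<^sup>2 * F 0 - f1 0)" for x
    using third_deriv_eq_cmult[OF F f1, of x] by simp
  then show ?thesis
    using \<open>\<mu> \<noteq> 0\<close>
    by (intro mem_span3I[of _ "(\<mu>\<^sup>2 * F 0 - f1 0) / \<mu>\<^sup>2" _ "A / \<mu>\<^sup>2" _ "B / \<mu>\<^sup>2"])
      (simp add: field_simps)
qed

text \<open>The vector \<open>(f1, \<mu> * f)\<close> rotates with angular speed \<mu>, so its
  components in a frame turning along with it are constant; rotating back gives
  \<open>f1\<close>.\<close>

lemma span_if_third_deriv_neg:
  fixes F f f1 :: "real \<Rightarrow> real"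
  assumes F: "\<And>x. (F has_real_derivative f x) (at x)"
    and f: "\<And>x. (f has_real_derivative f1 x) (at x)"
    and f1: "\<And>x. (f1 has_real_derivative - \<mu>\<^sup>2 * f x) (at x)"
    and "\<mu> \<noteq> 0"
  shows "F \<in> span {(\<lambda>x. 1), (\<lambda>x. sin (\<mu> * x)), (\<lambda>x. cos (\<mu> * x))}"
proof -
  have "((\<lambda>x. f1 x * cos (\<mu> * x) + \<mu> * f x * sin (\<mu> * x)) has_real_derivative 0) (at x)" for x
    by (rule derivative_eq_intros f f1 refl)+ (simp add: power2_eq_square algebra_simps)
  then have "f1 x * cos (\<mu> * x) + \<mu> * f x * sin (\<mu> * x)
      = f1 0 * cos (\<mu> * 0) + \<mu> * f 0 * sin (\<mu> * 0)" for x
    by (rule DERIV_isconst_all[rule_format])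
  then have c: "f1 x * cos (\<mu> * x) + \<mu> * f x * sin (\<mu> * x) = f1 0" for x
    by simp
  have "((\<lambda>x. f1 x * sin (\<mu> * x) - \<mu> * f x * cos (\<mu> * x)) has_real_derivative 0) (at x)" for x
    by (rule derivative_eq_intros f f1 refl)+ (simp add: power2_eq_square algebra_simps)
  then have "f1 x * sin (\<mu> * x) - \<mu> * f x * cos (\<mu> * x)
      = f1 0 * sin (\<mu> * 0) - \<mu> * f 0 * cos (\<mu> * 0)" for x
    by (rule DERIV_isconst_all[rule_format])
  then have s: "f1 x * sin (\<mu> * x) - \<mu> * f x * cos (\<mu> * x) = - \<mu> * f 0" for x
    by simp
  have sol: "f1 x = f1 0 * cos (\<mu> * x) - \<mu> * f 0 * sin (\<mu> * x)" for x
  proof -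
    have "f1 x = f1 x * ((sin (\<mu> * x))\<^sup>2 + (cos (\<mu> * x))\<^sup>2)"
      by simp
    also have "\<dots> = (f1 x * cos (\<mu> * x) + \<mu> * f x * sin (\<mu> * x)) * cos (\<mu> * x)
        + (f1 x * sin (\<mu> * x) - \<mu> * f x * cos (\<mu> * x)) * sin (\<mu> * x)"
      by algebra
    finally show ?thesis
      unfolding c s by simp
  qed
  have "\<mu>\<^sup>2 * F x = \<mu> * f 0 * sin (\<mu> * x) - f1 0 * cos (\<mu> * x) + (\<mu>\<^sup>2 * F 0 + f1 0)" for x
    using third_deriv_eq_cmult[OF F f1, of x] sol[of x] by simp
  then have "F x = (\<mu> * f 0 * sin (\<mu> * x) - f1 0 * cos (\<mu> * x) + (\<mu>\<^sup>2 * F 0 + f1 0)) / \<mu>\<^sup>2" for x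
    using \<open>\<mu> \<noteq> 0\<close> by (metis nonzero_mult_div_cancel_left power_not_zero)
  also have "(\<mu> * f 0 * sin (\<mu> * x) - f1 0 * cos (\<mu> * x) + (\<mu>\<^sup>2 * F 0 + f1 0)) / \<mu>\<^sup>2
      = (\<mu>\<^sup>2 * F 0 + f1 0) / \<mu>\<^sup>2 * 1 + \<mu> * f 0 / \<mu>\<^sup>2 * sin (\<mu> * x)
        + - f1 0 / \<mu>\<^sup>2 * cos (\<mu> * x)" for x
    by (simp add: add_divide_distrib diff_divide_distrib)
  finally show ?thesis
    by (rule mem_span3I)
qed

section \<open>Constancy of the multiplier when the Wronskian is nonzero\<close>

lemma second_derivs_proportional:
  fixes f g f1 g1 f2 g2 :: "real \<Rightarrow> real"
  assumes f: "\<And>x. (f has_real_derivative f1 x) (at x)"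
    and g: "\<And>x. (g has_real_derivative g1 x) (at x)"
    and f1: "\<And>x. (f1 has_real_derivative f2 x) (at x)"
    and g1: "\<And>x. (g1 has_real_derivative g2 x) (at x)"
    and E: "\<And>x h. (f (x + h) + f (x - h)) * g x = (g (x + h) + g (x - h)) * f x"
    and E2: "\<And>x h. (f2 (x + h) + f2 (x - h)) * g x = (g2 (x + h) + g2 (x - h)) * f x"
    and W: "\<And>x. f1 x * g x - g1 x * f x = w" and "w \<noteq> 0"
  obtains q where "\<And>x. f2 x = q * f x" and "\<And>x. g2 x = q * g x"
proof -
  \<comment> \<open>Projecting \<open>(f2, g2)\<close> onto \<open>(f, g)\<close> avoids a case
    split on which component vanishes; a common zero would make the Wronskian zero.\<close>
  define q where "q = (\<lambda>x. (f x * f2 x + g x * g2 x) / ((f x)\<^sup>2 + (g x)\<^sup>2))"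
  have par: "f2 x * g x = g2 x * f x" for x
    using E2[of x 0] by simp
  have "f x \<noteq> 0 \<or> g x \<noteq> 0" for x
    using W[of x] \<open>w \<noteq> 0\<close> by auto
  then have nz: "(f x)\<^sup>2 + (g x)\<^sup>2 \<noteq> 0" for x
    by (simp add: sum_power2_eq_zero_iff)
  have fq: "f2 x = q x * f x" for x
    unfolding q_def using nz[of x] par[of x]
    by (simp add: divide_simps) (simp add: power2_eq_square algebra_simps)
  have gq: "g2 x = q x * g x" for x
    unfolding q_def using nz[of x] par[of x]
    by (simp add: divide_simps) (simp add: power2_eq_square algebra_simps)
  \<comment> \<open>Subtracting \<open>q (x + h)\<close> times \<open>E\<close> from
    \<open>E2\<close> cancels all terms at \<open>x + h\<close>.\<close>
  have key: "(q (x + h) - q (x - h)) * (f (x - h) * g x - g (x - h) * f x) = 0" for x h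
    using E[of x h] E2[of x h] unfolding fq gq by algebra
  have const: "q x = q y" for x y
  proof (rule locally_constant_real_imp_constant[of q])
    fix x
    obtain d where d: "d > 0"
      "\<And>s t. \<bar>s - x\<bar> < d \<Longrightarrow> \<bar>t - x\<bar> < d \<Longrightarrow> s < t \<Longrightarrow> f s * g t - g s * f t \<noteq> 0"
      using minor_nonzero_near[OF f g DERIV_isCont[OF f1] DERIV_isCont[OF g1], of x] W[of x] \<open>w \<noteq> 0\<close>
      by blast
    have *: "q s = q t" if "\<bar>s - x\<bar> < d" "\<bar>t - x\<bar> < d" "s < t" for s t
    proof -
      \<comment> \<open>In \<open>key\<close>, the midpoint with half the distance as
        \<open>h\<close> puts \<open>x - h\<close> at \<open>s\<close> and \<open>x + h\<close> at
        \<open>t\<close>.\<close>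
      have "f s * g ((s + t) / 2) - g s * f ((s + t) / 2) \<noteq> 0"
        using that by (intro d) (auto simp: abs_if field_simps split: if_splits)
      then show ?thesis
        using key[of "(s + t) / 2" "(t - s) / 2"] by (simp flip: add_divide_distrib diff_divide_distrib)
    qed
    have "q y = q x" if "\<bar>y - x\<bar> < d" for y
      using *[of x y] *[of y x] that d(1) by (metis linorder_neqE abs_zero diff_self)
    then show "\<exists>d>0. \<forall>y. \<bar>y - x\<bar> < d \<longrightarrow> q y = q x"
      using d(1) by blast
  qed
  show thesis
    by (rule that[of "q 0"]) (use fq gq const[of _ 0] in metis)+
qed

section \<open>Reduction to a differential equation and case distinction\<close>

theorem theorem2:
  fixes F G f g :: "real \<Rightarrow> real"
  assumes "times_differentiable 3 F" and "times_differentiable 3 G"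
    and "\<And>x. (F has_real_derivative f x) (at x)"
    and "\<And>x. (G has_real_derivative g x) (at x)"
    and "\<And>a b. (F b - F a) * g ((a + b) / 2) = (G b - G a) * f ((a + b) / 2)"
  shows "linearly_dependent [(\<lambda>x. 1), F, G]
    \<or> (F \<in> span {(\<lambda>x. 1), (\<lambda>x. x), (\<lambda>x. x\<^sup>2)} \<and> G \<in> span {(\<lambda>x. 1), (\<lambda>x. x), (\<lambda>x. x\<^sup>2)})
    \<or> (\<exists>\<mu>. \<mu> \<noteq> 0 \<and>
         F \<in> span {(\<lambda>x. 1), (\<lambda>x. exp (\<mu> * x)), (\<lambda>x. exp (- \<mu> * x))} \<and>
         G \<in> span {(\<lambda>x. 1), (\<lambda>x. exp (\<mu> * x)), (\<lambda>x. exp (- \<mu> * x))})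
    \<or> (\<exists>\<mu>. \<mu> \<noteq> 0 \<and>
         F \<in> span {(\<lambda>x. 1), (\<lambda>x. sin (\<mu> * x)), (\<lambda>x. cos (\<mu> * x))} \<and>
         G \<in> span {(\<lambda>x. 1), (\<lambda>x. sin (\<mu> * x)), (\<lambda>x. cos (\<mu> * x))})"
proof -
  note F = assms(3) and G = assms(4) and eq = assms(5)
  obtain f1 f2 where f: "\<And>x. (f has_real_derivative f1 x) (at x)"
    and f1: "\<And>x. (f1 has_real_derivative f2 x) (at x)"
    using times_differentiable_3E[OF assms(1) F] by blast
  obtain g1 g2 where g: "\<And>x. (g has_real_derivative g1 x) (at x)"
    and g1: "\<And>x. (g1 has_real_derivative g2 x) (at x)"
    using times_differentiable_3E[OF assms(2) G] by blast
  \<comment> \<open>The coefficients \<open>-1\<close> and \<open>1\<close> stay explicit to fit the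
    \<open>c\<close> of \<open>symmetric_difference_eq_deriv\<close>.\<close>
  have E0: "(F (x + h) + (-1) * F (x - h)) * g x = (G (x + h) + (-1) * G (x - h)) * f x" for x h
    using eq[of "x + h" "x - h"] by simp
  have E1: "(f (x + h) + 1 * f (x - h)) * g x = (g (x + h) + 1 * g (x - h)) * f x" for x h
    using symmetric_difference_eq_deriv[OF F G E0, of x h] by simp
  have E2: "(f1 (x + h) + (-1) * f1 (x - h)) * g x = (g1 (x + h) + (-1) * g1 (x - h)) * f x" for x h
    using symmetric_difference_eq_deriv[OF f g E1, of x h] by simp
  have E3: "(f2 (x + h) + f2 (x - h)) * g x = (g2 (x + h) + g2 (x - h)) * f x" for x h
    using symmetric_difference_eq_deriv[OF f1 g1 E2, of x h] by simp
  define w where "w = f1 0 * g 0 - g1 0 * f 0"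
  \<comment> \<open>The products of first derivatives cancel, leaving
    \<open>f2 x * g x - g2 x * f x\<close>, which is zero by \<open>E3\<close> at
    \<open>h = 0\<close>.\<close>
  have "((\<lambda>x. f1 x * g x - g1 x * f x) has_real_derivative 0) (at x)" for x
    by (rule derivative_eq_intros f g f1 g1 refl)+ (use E3[of x 0] in \<open>simp add: algebra_simps\<close>)
  then have W: "f1 x * g x - g1 x * f x = w" for x
    unfolding w_def by (rule DERIV_isconst_all[rule_format])
  show ?thesis
  proof (cases "w = 0")
    case True
    then have "f1 x * g x = g1 x * f x" for x
      using W[of x] by simp
    with G f g eq have "linearly_dependent [(\<lambda>x. 1), F, G]"
      by (rule linearly_dependent_if_wronskian_0)
    then show ?thesis ..
  next
    case False
    obtain q where "\<And>x. f2 x = q * f x" "\<And>x. g2 x = q * g x"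
      using second_derivs_proportional[OF f g f1 g1 _ E3 W False] E1 by auto
    with f1 g1 have f1: "\<And>x. (f1 has_real_derivative q * f x) (at x)"
      and g1: "\<And>x. (g1 has_real_derivative q * g x) (at x)"
      by simp_all
    consider "q = 0" | \<mu> where "\<mu> \<noteq> 0" "q = \<mu>\<^sup>2" | \<mu> where "\<mu> \<noteq> 0" "q = - \<mu>\<^sup>2"
    proof (cases q "0 :: real" rule: linorder_cases)
      case less
      then show thesis
        using that(3)[of "sqrt (- q)"] by simp
    next
      case greater
      then show thesis
        using that(2)[of "sqrt q"] by simp
    qed (rule that)
    then show ?thesis
    proof cases
      case 1
      with f1 g1 have "\<And>x. (f1 has_real_derivative 0) (at x)" "\<And>x. (g1 has_real_derivative 0) (at x)"
        by simp_all
      then show ?thesis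
        using span_if_third_deriv_0[OF F f] span_if_third_deriv_0[OF G g] by blast
    next
      case 2
      note f1 = f1[unfolded 2(2)] and g1 = g1[unfolded 2(2)]
      show ?thesis
        using 2(1) span_if_third_deriv_pos[OF F f f1] span_if_third_deriv_pos[OF G g g1] by blast
    next
      case 3
      note f1 = f1[unfolded 3(2)] and g1 = g1[unfolded 3(2)]
      show ?thesis
        using 3(1) span_if_third_deriv_neg[OF F f f1] span_if_third_deriv_neg[OF G g g1] by blast
    qed
  qed
qed

end
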